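(* If $c$ is a positive integer and $n,k$ are positive integers with $n\ge(c+1)k$, then $$a_c(n,k)=\binom{n-k-1}{k}-(c-2)\sum_{j=0}^{k-1}\binom{n-k-1}{j}.$$
   Context: $\Bbbk$ is a field of characteristic $0$; $\mathcal{M}$ is the free monoid on letters $D,U$; $\mathcal{W}=\Bbbk\langle D,U\mid DU-UD=1\rangle$; $\phi:\mathcal{M}\to\mathcal{W}$ is the monoid morphism with $D\mapsto D,U\mapsto U$; words $u,v$ are Weyl-equivalent if $\phi(u)=\phi(v)$. For $c>0$, $\mathcal{M}_c$ is the set of words every prefix of which contains at least $c$ times as many $U$'s as $D$'s. $a_c(n,k)$ is the number of Weyl-equivalence classes that contain a word of $\mathcal{M}_c$ consisting of $k$ letters $D$ and $n-k$ letters $U$. *)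

theory Defs
  imports
    Complex_Main
    "HOL-Library.Sublist"
    "HOL-Library.Poly_Mapping"
    "HOL-Algebra.QuotRing"
begin

datatype letter = D | U

text \<open>
  The free monoid on the letters is \<open>letter list\<close> with append.  The convolution product on
  \<open>'a \<Rightarrow>\<^sub>0 'k\<close> requires the exponents to form a \<open>monoid_add\<close>, so \<open>word\<close> is a copy of that
  monoid written additively (and not commutative); it only serves as the basis of the free algebra.
\<close>

datatype word = Word (letters: "letter list")

instantiation word :: monoid_add
begin

definition "0 = Word []"

definition "v + w = Word (letters v @ letters w)"

instance
  by standard (simp_all add: zero_word_def plus_word_def)

end

definition free_algebra :: "(word \<Rightarrow>\<^sub>0 'k::field) ring" where
  "free_algebra = \<lparr>carrier = UNIV, mult = (*), one = 1, zero = 0, add = (+)\<rparr>"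

lemma ring_free_algebra: "ring (free_algebra :: (word \<Rightarrow>\<^sub>0 'k::field) ring)"
proof (rule ringI)
  show "abelian_group (free_algebra :: (word \<Rightarrow>\<^sub>0 'k) ring)"
  proof (rule abelian_groupI)
    fix x :: "word \<Rightarrow>\<^sub>0 'k"
    show "\<exists>y\<in>carrier free_algebra. y \<oplus>\<^bsub>free_algebra\<^esub> x = \<zero>\<^bsub>free_algebra\<^esub>"
      by (rule bexI[of _ "- x"]) (simp_all add: free_algebra_def)
  qed (simp_all add: free_algebra_def add_ac)
  show "monoid (free_algebra :: (word \<Rightarrow>\<^sub>0 'k) ring)"
    by (rule monoidI) (simp_all add: free_algebra_def mult.assoc)
qed (simp_all add: free_algebra_def distrib_left distrib_right)

definition letter_poly :: "letter \<Rightarrow> (word \<Rightarrow>\<^sub>0 'k::field)" where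
  "letter_poly x = Poly_Mapping.single (Word [x]) 1"

text \<open>
  The ideal generated by a set, \<open>Idl\<close>, is two-sided; since the scalars lie in the free algebra,
  it is automatically a linear subspace.
\<close>

definition weyl_ideal :: "(word \<Rightarrow>\<^sub>0 'k::field) set" where
  "weyl_ideal =
     Idl\<^bsub>free_algebra\<^esub> {letter_poly D * letter_poly U - letter_poly U * letter_poly D - 1}"

definition weyl_algebra :: "(word \<Rightarrow>\<^sub>0 'k::field) set ring" where
  "weyl_algebra = free_algebra Quot weyl_ideal"

lemma ideal_weyl_ideal: "ideal (weyl_ideal :: (word \<Rightarrow>\<^sub>0 'k::field) set) free_algebra"
  unfolding weyl_ideal_def
  by (rule ring.genideal_ideal[OF ring_free_algebra]) (simp add: free_algebra_def)

lemma ring_weyl_algebra: "ring (weyl_algebra :: (word \<Rightarrow>\<^sub>0 'k::field) set ring)"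
  unfolding weyl_algebra_def by (rule ideal.quotient_is_ring[OF ideal_weyl_ideal])

definition weyl_gen :: "letter \<Rightarrow> (word \<Rightarrow>\<^sub>0 'k::field) set" where
  "weyl_gen x = weyl_ideal +>\<^bsub>free_algebra\<^esub> letter_poly x"

primrec weyl_phi :: "letter list \<Rightarrow> (word \<Rightarrow>\<^sub>0 'k::field) set" where
  "weyl_phi [] = \<one>\<^bsub>weyl_algebra\<^esub>"
| "weyl_phi (x # w) = weyl_gen x \<otimes>\<^bsub>weyl_algebra\<^esub> weyl_phi w"

definition weyl_equiv :: "'k::field itself \<Rightarrow> (letter list \<times> letter list) set" where
  "weyl_equiv _ = {(u, v). (weyl_phi u :: (word \<Rightarrow>\<^sub>0 'k) set) = weyl_phi v}"

definition words_M :: "real \<Rightarrow> letter list set" where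
  "words_M c =
     {w. \<forall>p. prefix p w \<longrightarrow> real (count_list p U) \<ge> c * real (count_list p D)}"

definition num_classes :: "'k::field itself \<Rightarrow> real \<Rightarrow> nat \<Rightarrow> nat \<Rightarrow> nat" where
  "num_classes K c n k =
     card {C \<in> UNIV // weyl_equiv K.
       \<exists>w\<in>C. w \<in> words_M c \<and> length w = n \<and> count_list w D = k}"

end

theory Submission
  imports Defs "HOL-Computational_Algebra.Polynomial"
begin

text \<open>
  Call \<open>#U - #D\<close> the height of a word.  On (Laurent) monomials, \<open>D\<close> acting as differentiation and
  \<open>U\<close> as multiplication by the variable, a word acts as a shift by its height times the product of
  the linear factors given by the heights just before its letters \<open>D\<close>.  Conversely, a word all of
  whose prefixes have nonnegative height equals \<open>\<Prod> (UD - (h - 1)) U\<^sup>d\<close> in the Weyl algebra, where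
  \<open>h\<close> runs over these heights and \<open>d\<close> is the height of the word.  So, for words of the same height
  in \<open>words_M c\<close>, Weyl equivalence is equality of the multisets of heights before the letters \<open>D\<close>.

  Put \<open>a = c - 1\<close> and \<open>H = n - 2k + 1\<close>.  The multisets that occur are those of size \<open>k\<close> which have
  fewer than \<open>i\<close> elements in \<open>{..a i}\<close> for all \<open>i \<ge> 1\<close> and no gap between \<open>H\<close> and their maximum.  If
  \<open>A\<^sub>k\<close> is their number and \<open>B\<^sub>k\<close> the number of those with all elements below \<open>H\<close> (a ballot number),
  then removing the maximum gives \<open>A\<^sub>k\<^sub>+\<^sub>1 = B\<^sub>k\<^sub>+\<^sub>1 + B\<^sub>k + 2 (A\<^sub>k - B\<^sub>k)\<close>, from which the formula
  follows by induction.
\<close>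

section \<open>Ballot multisets\<close>

definition ballot :: "int \<Rightarrow> int multiset \<Rightarrow> bool" where
  "ballot a S \<longleftrightarrow> (\<forall>i\<ge>1. size {#x \<in># S. x \<le> a * int i#} < i)"

definition ballot_below :: "int \<Rightarrow> int \<Rightarrow> nat \<Rightarrow> int multiset set" where
  "ballot_below a H k = {S. size S = k \<and> ballot a S \<and> (\<forall>x\<in>#S. x < H)}"

definition ballot_sets :: "int \<Rightarrow> int \<Rightarrow> nat \<Rightarrow> int multiset set" where
  "ballot_sets a H k = {S. size S = k \<and> ballot a S \<and> (\<forall>x\<in>#S. x > H \<longrightarrow> x - 1 \<in># S)}"

lemma ballot_empty [simp]: "ballot a {#}"
  by (simp add: ballot_def)

lemma ballot_mono: "ballot a S" if "ballot a T" "S \<subseteq># T"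
  unfolding ballot_def
proof (intro allI impI)
  fix i :: nat assume "i \<ge> 1"
  with that(1) have "size {#x \<in># T. x \<le> a * int i#} < i" by (simp add: ballot_def)
  with size_mset_mono[OF multiset_filter_mono[OF that(2)]]
  show "size {#x \<in># S. x \<le> a * int i#} < i" by (rule le_less_trans)
qed

lemma ballot_add_mset:
  assumes "a \<ge> 0" "ballot a S" "x > a * int (Suc (size S))"
  shows "ballot a (add_mset x S)"
  unfolding ballot_def
proof (intro allI impI)
  fix i :: nat assume i: "i \<ge> 1"
  show "size {#y \<in># add_mset x S. y \<le> a * int i#} < i"
  proof (cases "i \<le> Suc (size S)")
    case True
    then have "a * int i \<le> a * int (Suc (size S))"
      using assms(1) by (intro mult_left_mono) auto
    with assms i show ?thesis by (auto simp: ballot_def)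
  next
    case False
    have "size {#y \<in># add_mset x S. y \<le> a * int i#} \<le> size (add_mset x S)"
      by (rule size_filter_mset_lesseq)
    with False show ?thesis by simp
  qed
qed

lemma ballot_obtain_large:
  assumes "ballot a S" "S \<noteq> {#}"
  obtains x where "x \<in># S" "x > a * int (size S)"
proof -
  have "size {#x \<in># S. x \<le> a * int (size S)#} < size S"
    using assms by (auto simp: ballot_def Suc_le_eq nonempty_has_size)
  then have "{#x \<in># S. x \<le> a * int (size S)#} \<noteq> S" by auto
  then have "\<exists>x\<in>#S. x > a * int (size S)"
    by (metis filter_mset_True filter_mset_cong0 linorder_not_le)
  with that show thesis by auto
qed

lemma ballot_below_0 [simp]: "ballot_below a H 0 = {{#}}"
  by (auto simp: ballot_below_def)

lemma ballot_below_eq_empty: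
  assumes "k > 0" "H \<le> a * int k + 1"
  shows "ballot_below a H k = {}"
proof (rule equals0I)
  fix S assume "S \<in> ballot_below a H k"
  then have S: "size S = k" "ballot a S" "\<forall>x\<in>#S. x < H" by (auto simp: ballot_below_def)
  with assms(1) have "S \<noteq> {#}" by auto
  with S obtain x where "x \<in># S" "x > a * int k" by (metis ballot_obtain_large)
  with S assms(2) show False by force
qed

lemma ballot_below_Suc:
  assumes "a \<ge> 0" "H > a * int (Suc k)"
  shows "ballot_below a (H + 1) (Suc k) =
    ballot_below a H (Suc k) \<union> add_mset H ` ballot_below a (H + 1) k"
proof (intro equalityI subsetI)
  fix S assume S: "S \<in> ballot_below a (H + 1) (Suc k)"
  show "S \<in> ballot_below a H (Suc k) \<union> add_mset H ` ballot_below a (H + 1) k"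
  proof (cases "H \<in># S")
    case True
    then obtain T where T: "S = add_mset H T" by (metis mset_add)
    with S have "T \<in> ballot_below a (H + 1) k"
      using ballot_mono[of a S T] by (auto simp: ballot_below_def)
    with T show ?thesis by auto
  next
    case False
    with S show ?thesis by (fastforce simp: ballot_below_def)
  qed
next
  fix S assume "S \<in> ballot_below a H (Suc k) \<union> add_mset H ` ballot_below a (H + 1) k"
  with assms show "S \<in> ballot_below a (H + 1) (Suc k)"
    by (force simp: ballot_below_def intro!: ballot_add_mset)
qed

lemma pascal_pred: "int (n choose Suc j) = int ((n - 1) choose Suc j) + int ((n - 1) choose j)"
  if "n > 0"
  using that by (cases n) auto

lemma card_ballot_below_aux:
  "finite (ballot_below (int a) (int (a * k + 1 + d)) k) \<and>
   int (card (ballot_below (int a) (int (a * k + 1 + d)) k)) =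
     int ((a * k + d + k - 1) choose k) -
     int a * (if k = 0 then 0 else int ((a * k + d + k - 1) choose (k - 1)))"
proof (induction k arbitrary: d)
  case 0
  then show ?case by simp
next
  case (Suc k)
  note IHk = Suc.IH
  show ?case
  proof (induction d)
    case 0
    define m where "m = a * Suc k + k"
    have "Suc k * (m choose Suc k) = (m - k) * (m choose k)"
      by (metis binomial_absorb_comp binomial_absorption mult.commute diff_Suc_1)
    moreover have "m - k = Suc k * a" by (simp add: m_def)
    ultimately have "Suc k * (m choose Suc k) = Suc k * (a * (m choose k))"
      by (simp only: mult.assoc)
    then have "(m choose Suc k) = a * (m choose k)"
      by (metis mult_cancel1 nat.distinct(1))
    then have "int (m choose Suc k) = int a * int (m choose k)"
      by (metis of_nat_mult)
    moreover have "ballot_below (int a) (int (a * Suc k + 1)) (Suc k) = {}"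
      by (rule ballot_below_eq_empty) (auto simp: algebra_simps)
    ultimately show ?case by (simp add: m_def)
  next
    case (Suc d)
    let ?H = "int (a * Suc k + 1 + d)"
    let ?X = "ballot_below (int a) ?H (Suc k)" and ?Y = "ballot_below (int a) (?H + 1) k"
    have Y: "?Y = ballot_below (int a) (int (a * k + 1 + (a + d + 1))) k"
      by (simp add: algebra_simps)
    have eq: "ballot_below (int a) (int (a * Suc k + 1 + Suc d)) (Suc k) = ?X \<union> add_mset ?H ` ?Y"
    proof -
      have "?H > int a * int (Suc k)"
        by (metis of_nat_mult of_nat_less_iff add.assoc less_add_same_cancel1 zero_less_one add_pos_nonneg zero_le)
      from ballot_below_Suc[OF _ this] show ?thesis by (simp add: add_ac)
    qed
    have disj: "?X \<inter> add_mset ?H ` ?Y = {}"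
      by (auto simp: ballot_below_def)
    have finX: "finite ?X" and finY: "finite ?Y"
      using Suc IHk[of "a + d + 1"] unfolding Y by blast+
    have "card (?X \<union> add_mset ?H ` ?Y) = card ?X + card ?Y"
      using disj finX finY by (simp add: card_Un_disjoint card_image inj_on_def)
    moreover
    let ?n = "a * Suc k + Suc d + Suc k - 1"
    have n: "?n > 0" "?n - 1 = a * Suc k + d + Suc k - 1"
        "a * k + (a + d + 1) + k - 1 = ?n - 1"
      by auto
    have "int (card ?X) = int ((?n - 1) choose Suc k) - int a * int ((?n - 1) choose k)"
      using Suc unfolding n by simp
    moreover have "int (card ?Y) = int ((?n - 1) choose k) -
        int a * (if k = 0 then 0 else int ((?n - 1) choose (k - 1)))"
      using IHk[of "a + d + 1"] unfolding Y n by blast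
    moreover have "int (?n choose k) =
       int ((?n - 1) choose k) + (if k = 0 then 0 else int ((?n - 1) choose (k - 1)))"
      using pascal_pred[OF n(1), of "k - 1"] by (cases k) auto
    ultimately show ?case unfolding eq using finX finY pascal_pred[OF n(1), of k]
      by (simp add: algebra_simps)
  qed
qed

lemma card_ballot_below:
  assumes "h \<ge> a * k + 1"
  shows "finite (ballot_below (int a) (int h) k)"
    and "int (card (ballot_below (int a) (int h) k)) =
     int ((h + k - 2) choose k) -
     int a * (if k = 0 then 0 else int ((h + k - 2) choose (k - 1)))"
  using card_ballot_below_aux[of a k "h - (a * k + 1)"] assms
  by (simp_all add: Suc_diff_Suc numeral_2_eq_2)

lemma ballot_sets_0 [simp]: "ballot_sets a H 0 = {{#}}"
  by (auto simp: ballot_sets_def)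

lemma ballot_below_subset: "ballot_below a H k \<subseteq> ballot_sets a H k"
  by (auto simp: ballot_sets_def ballot_below_def)

lemma Max_mset_ge_if_not_below:
  assumes "S \<in> ballot_sets a H k - ballot_below a H k"
  shows "S \<noteq> {#}" "H \<le> Max_mset S"
proof -
  obtain x where "x \<in># S" "x \<ge> H"
    using assms by (auto simp: ballot_sets_def ballot_below_def not_less)
  then show "S \<noteq> {#}" "H \<le> Max_mset S"
    by (auto intro: order_trans[OF _ Max_ge])
qed

lemma bottom_in_ballot_sets:
  assumes "S \<in> ballot_sets a H k" "x \<in># S" "x \<ge> H"
  shows "H \<in># S"
  using assms(3,2)
proof (induction x rule: int_ge_induct)
  case (step x)
  then show ?case using assms(1) by (force simp: ballot_sets_def)
qed

lemma ballot_sets_Suc: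
  assumes "a \<ge> 0" "H > a * int (Suc k)"
  defines "N \<equiv> ballot_sets a H k - ballot_below a H k"
  shows "ballot_sets a H (Suc k) = ballot_below a H (Suc k) \<union> add_mset H ` ballot_below a H k \<union>
    (\<lambda>S. add_mset (Max_mset S) S) ` N \<union> (\<lambda>S. add_mset (Max_mset S + 1) S) ` N"
    (is "?L = ?B \<union> ?H \<union> ?M \<union> ?M1")
proof (intro equalityI subsetI)
  fix S assume S: "S \<in> ?L"
  show "S \<in> ?B \<union> ?H \<union> ?M \<union> ?M1"
  proof (cases "S \<in> ?B")
    case False
    with S have ne: "S \<noteq> {#}" and ge: "H \<le> Max_mset S"
      using Max_mset_ge_if_not_below by blast+
    define M where "M = Max_mset S"
    have M: "M \<in># S" "\<And>x. x \<in># S \<Longrightarrow> x \<le> M"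
      using ne by (auto simp: M_def)
    then obtain T where T: "S = add_mset M T" by (metis mset_add)
    have sz: "size T = k" using S T by (auto simp: ballot_sets_def)
    have bal: "ballot a T" using S T ballot_mono[of a S T] by (auto simp: ballot_sets_def)
    have TA: "T \<in> ballot_sets a H k"
      using S sz bal M(2) unfolding ballot_sets_def T by force
    show ?thesis
    proof (cases "T \<in> ballot_below a H k")
      case True
      have "M = H"
      proof (rule ccontr)
        assume "M \<noteq> H"
        then have "M > H" using ge M_def by simp
        then have "M - 1 \<in># T" using S T by (auto simp: ballot_sets_def)
        then show False using True \<open>M > H\<close> by (auto simp: ballot_below_def)
      qed
      with T True show ?thesis by auto
    next
      case False
      with TA have TN: "T \<in> N" by (simp add: N_def)
      have Tne: "T \<noteq> {#}" and Tge: "H \<le> Max_mset T"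
        using Max_mset_ge_if_not_below TN unfolding N_def by blast+
      have le: "Max_mset T \<le> M" using Tne M(2) T by auto
      have "M = Max_mset T \<or> M = Max_mset T + 1"
      proof (rule ccontr)
        assume *: "\<not> ?thesis"
        then have "M - 1 \<in># S" using S M(1) Tge le unfolding ballot_sets_def by auto
        then have "M - 1 \<in># T" using T by auto
        then have "M - 1 \<le> Max_mset T" by auto
        with * le show False by auto
      qed
      with T TN show ?thesis by auto
    qed
  qed simp
next
  fix S assume "S \<in> ?B \<union> ?H \<union> ?M \<union> ?M1"
  then consider "S \<in> ?B" | "S \<in> ?H" | T x where "T \<in> N" "S = add_mset x T"
      "x = Max_mset T \<or> x = Max_mset T + 1"
    by blast
  then show "S \<in> ?L"
  proof cases
    case 1
    then show ?thesis using ballot_below_subset by blast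
  next
    case 2
    then show ?thesis using assms(1,2)
      by (force simp: ballot_sets_def ballot_below_def intro!: ballot_add_mset)
  next
    case 3
    then have ge: "T \<noteq> {#}" "H \<le> Max_mset T" and TA: "T \<in> ballot_sets a H k"
      using Max_mset_ge_if_not_below unfolding N_def by blast+
    then have mx: "Max_mset T \<in># T" by simp
    have "ballot a S" using 3 TA ge assms(1,2)
      by (auto simp: ballot_sets_def intro!: ballot_add_mset)
    with 3 TA mx show ?thesis by (auto simp: ballot_sets_def)
  qed
qed

lemma card_ballot_sets_Suc:
  assumes "a \<ge> 0" "H > a * int (Suc k)"
    and fin: "finite (ballot_sets a H k)" "finite (ballot_below a H (Suc k))"
  shows "finite (ballot_sets a H (Suc k))"
    and "int (card (ballot_sets a H (Suc k))) = int (card (ballot_below a H (Suc k)))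
      + 2 * int (card (ballot_sets a H k)) - int (card (ballot_below a H k))"
proof -
  define N where "N = ballot_sets a H k - ballot_below a H k"
  let ?B = "ballot_below a H (Suc k)" and ?H = "add_mset H ` ballot_below a H k"
    and ?M = "(\<lambda>S. add_mset (Max_mset S) S) ` N" and ?M1 = "(\<lambda>S. add_mset (Max_mset S + 1) S) ` N"
  note eq = ballot_sets_Suc[OF assms(1,2), folded N_def]
  have finB: "finite (ballot_below a H k)"
    by (rule finite_subset[OF ballot_below_subset fin(1)])
  have finN: "finite N" using fin by (simp add: N_def)
  show "finite (ballot_sets a H (Suc k))"
    unfolding eq using fin finB finN by simp
  have NP: "S \<noteq> {#}" "H \<le> Max_mset S" if "S \<in> N" for S
    using that Max_mset_ge_if_not_below unfolding N_def by blast+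
  have mx: "Max_mset (add_mset (Max_mset S) S) = Max_mset S"
    "Max_mset (add_mset (Max_mset S + 1) S) = Max_mset S + 1" if "S \<in> N" for S
    using NP[OF that] by auto
  have inj: "inj_on (\<lambda>S. add_mset (Max_mset S) S) N"
    by (intro inj_onI) (metis mx(1) add_mset_add_mset_same_iff)
  have inj1: "inj_on (\<lambda>S. add_mset (Max_mset S + 1) S) N"
    by (intro inj_onI) (metis mx(2) add_mset_add_mset_same_iff)
  have injH: "inj_on (add_mset H) (ballot_below a H k)"
    by (auto simp: inj_on_def)
  have d1: "?B \<inter> ?H = {}" by (auto simp: ballot_below_def)
  have d2: "(?B \<union> ?H) \<inter> ?M = {}"
  proof -
    have "add_mset (Max_mset S) S \<notin> ?B \<union> ?H" if "S \<in> N" for S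
    proof
      have mem: "Max_mset S \<in># S" using NP[OF that] by simp
      assume "add_mset (Max_mset S) S \<in> ?B \<union> ?H"
      then consider "Max_mset S < H"
        | T where "T \<in> ballot_below a H k" "add_mset (Max_mset S) S = add_mset H T"
        by (auto simp: ballot_below_def)
      then show False
      proof cases
        case 2
        have "count (add_mset (Max_mset S) S) (Max_mset S) \<ge> 2" using mem by simp
        then have "count (add_mset H T) (Max_mset S) \<ge> 2" using 2 by metis
        moreover have "count (add_mset H T) (Max_mset S) \<le> Suc (count T (Max_mset S))" by simp
        ultimately have "count T (Max_mset S) > 0" by linarith
        then have "Max_mset S \<in># T" by (simp only: count_greater_zero_iff)
        with NP[OF that] 2 show False by (auto simp: ballot_below_def)
      qed (use NP[OF that] in linarith)
    qed
    then have "X \<notin> ?B \<union> ?H" if "X \<in> ?M" for X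
      using that by (elim imageE) simp
    then show ?thesis unfolding disjoint_iff by blast
  qed
  have d3: "(?B \<union> ?H \<union> ?M) \<inter> ?M1 = {}"
  proof -
    have "add_mset (Max_mset S + 1) S \<notin> ?B \<union> ?H \<union> ?M" if "S \<in> N" for S
    proof
      assume *: "add_mset (Max_mset S + 1) S \<in> ?B \<union> ?H \<union> ?M"
      have cnt: "Max_mset S + 1 \<notin># S" using Max_ge[of "set_mset S"] by fastforce
      from * consider "Max_mset S + 1 < H"
        | T where "T \<in> ballot_below a H k" "add_mset (Max_mset S + 1) S = add_mset H T"
        | T where "T \<in> N" "add_mset (Max_mset S + 1) S = add_mset (Max_mset T) T"
        by (auto simp: ballot_below_def)
      then show False
      proof cases
        case 2
        have "Max_mset S + 1 \<in># add_mset H T" using 2 by (metis union_single_eq_member)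
        with NP[OF that] 2(1) show False by (auto simp: ballot_below_def)
      next
        case 3
        then have "Max_mset S + 1 = Max_mset T" by (metis mx that)
        then have "S = T" using 3 by simp
        with \<open>Max_mset S + 1 = Max_mset T\<close> show False by simp
      qed (use NP[OF that] in linarith)
    qed
    then have "X \<notin> ?B \<union> ?H \<union> ?M" if "X \<in> ?M1" for X
      using that by (elim imageE) simp
    then show ?thesis unfolding disjoint_iff by blast
  qed
  have "card (ballot_sets a H (Suc k)) = card ?B + card (ballot_below a H k) + card N + card N"
    unfolding eq using fin finB finN d1 d2 d3 inj inj1 injH
    by (simp add: card_Un_disjoint card_image)
  moreover have "int (card N) = int (card (ballot_sets a H k)) - int (card (ballot_below a H k))"
    unfolding N_def using fin finB ballot_below_subset
    by (simp add: card_Diff_subset of_nat_diff card_mono)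
  ultimately show "int (card (ballot_sets a H (Suc k))) = int (card ?B)
      + 2 * int (card (ballot_sets a H k)) - int (card (ballot_below a H k))"
    by simp
qed

lemma sum_pascal:
  "(\<Sum>j<Suc k. int (Suc n choose j)) = 2 * (\<Sum>j<k. int (n choose j)) + int (n choose k)"
  by (induction k) auto

lemma card_ballot_sets:
  assumes "h \<ge> a * k + 1"
  shows "finite (ballot_sets (int a) (int h) k) \<and>
    int (card (ballot_sets (int a) (int h) k)) =
      (\<Sum>j<Suc k. int ((h + k - 2) choose j)) - int a * (\<Sum>j<k. int ((h + k - 2) choose j))"
  using assms
proof (induction k)
  case (Suc k)
  have h: "h \<ge> a * k + 1" using Suc.prems by simp
  have less: "int h > int a * int (Suc k)"
    using Suc.prems by (metis of_nat_mult of_nat_less_iff Suc_eq_plus1 Suc_le_eq)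
  note IH = Suc.IH[OF h]
  note bb = card_ballot_below[OF h] card_ballot_below[OF Suc.prems]
  note rec = card_ballot_sets_Suc[OF of_nat_0_le_iff less conjunct1[OF IH] bb(3)]
  show ?case
  proof (intro conjI)
    show "finite (ballot_sets (int a) (int h) (Suc k))" by (rule rec(1))
    show "int (card (ballot_sets (int a) (int h) (Suc k))) =
      (\<Sum>j<Suc (Suc k). int ((h + Suc k - 2) choose j)) -
      int a * (\<Sum>j<Suc k. int ((h + Suc k - 2) choose j))"
    proof (cases k)
      \<comment> \<open>Pascal's rule is not available here: \<open>h + k - 2\<close> is truncated if \<open>h = 1\<close>.\<close>
      case 0
      then show ?thesis using rec(2) bb(4) Suc.prems by (simp add: of_nat_diff)
    next
      case (Suc l)
      define n where "n = h + k - 2"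
      have n: "h + Suc k - 2 = Suc n" "h + k - 2 = n" using Suc h by (auto simp: n_def)
      show ?thesis
        using rec(2) bb(2,4) IH Suc unfolding n sum_pascal
        by (simp add: algebra_simps)
    qed
  qed
qed simp

section \<open>Heights before the letters D\<close>

definition height :: "letter list \<Rightarrow> int" where
  "height w = int (count_list w U) - int (count_list w D)"

fun drops :: "int \<Rightarrow> letter list \<Rightarrow> int list" where
  "drops h [] = []"
| "drops h (U # w) = drops (h + 1) w"
| "drops h (D # w) = h # drops (h - 1) w"

lemma height_simps [simp]:
  "height [] = 0" "height (U # w) = height w + 1" "height (D # w) = height w - 1"
  "height (u @ v) = height u + height v"
  by (simp_all add: height_def)

lemma drops_append [simp]: "drops h (u @ v) = drops h u @ drops (h + height u) v"
  by (induction h u rule: drops.induct) (simp_all add: algebra_simps)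

lemma length_drops [simp]: "length (drops h w) = count_list w D"
  by (induction h w rule: drops.induct) auto

lemma length_eq_count_letters: "length w = count_list w U + count_list w D"
proof (induction w)
  case (Cons x w)
  then show ?case by (cases x) auto
qed simp

lemma words_M_Nil [simp]: "[] \<in> words_M c"
  by (simp add: words_M_def)

lemma words_M_snoc:
  "w @ [x] \<in> words_M c \<longleftrightarrow>
     w \<in> words_M c \<and> c * real (count_list (w @ [x]) D) \<le> real (count_list (w @ [x]) U)"
  unfolding words_M_def by (auto simp del: count_list_append)

lemma words_M_snoc_U:
  assumes "c \<ge> 0"
  shows "w @ [U] \<in> words_M c \<longleftrightarrow> w \<in> words_M c"
  using assms unfolding words_M_snoc by (fastforce simp: words_M_def)

lemma words_M_snoc_D:
  "w @ [D] \<in> words_M (real c) \<longleftrightarrow>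
     w \<in> words_M (real c) \<and> height w > (int c - 1) * int (Suc (count_list w D))"
proof -
  have "real c * (1 + real (count_list w D)) \<le> real (count_list w U) \<longleftrightarrow>
      c * Suc (count_list w D) \<le> count_list w U"
    by (metis of_nat_Suc of_nat_le_iff of_nat_mult add.commute)
  also have "\<dots> \<longleftrightarrow> int c * int (Suc (count_list w D)) \<le> int (count_list w U)"
    by (metis of_nat_le_iff of_nat_mult)
  also have "\<dots> \<longleftrightarrow> height w > (int c - 1) * int (Suc (count_list w D))"
    by (auto simp: height_def algebra_simps)
  finally show ?thesis by (simp add: words_M_snoc add.commute)
qed

lemma ballot_drops:
  assumes "c > 0" "w \<in> words_M (real c)"
  shows "ballot (int c - 1) (mset (drops 0 w))"
  using assms(2)
proof (induction w rule: rev_induct)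
  case (snoc x w)
  show ?case
  proof (cases x)
    case U
    with snoc assms(1) show ?thesis by (simp add: words_M_snoc_U)
  next
    case D
    with snoc assms(1) show ?thesis
      by (auto simp: words_M_snoc_D intro!: ballot_add_mset)
  qed
qed simp

lemma drops_no_gap:
  "x \<in> set (drops 0 w) \<Longrightarrow> x > height w + 1 \<Longrightarrow> x - 1 \<in> set (drops 0 w)"
proof (induction w rule: rev_induct)
  case (snoc y w)
  then show ?case by (cases y; cases "x = height w + 1") auto
qed simp

lemma drops_in_ballot_sets:
  assumes "c > 0" "w \<in> words_M (real c)"
  shows "mset (drops 0 w) \<in> ballot_sets (int c - 1) (height w + 1) (count_list w D)"
  using ballot_drops[OF assms] drops_no_gap[of _ w] by (auto simp: ballot_sets_def)

lemma word_of_ballot_set: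
  assumes "c > 0" "S \<in> ballot_sets (int c - 1) H k" "H > (int c - 1) * int k"
  shows "\<exists>w\<in>words_M (real c). height w + 1 = H \<and> mset (drops 0 w) = S"
  using assms(2,3)
proof (induction k arbitrary: S H)
  case 0
  have "\<exists>w\<in>words_M (real c). height w = int m \<and> mset (drops 0 w) = {#}" for m
  proof (induction m)
    case 0
    show ?case by (intro bexI[of _ "[]"]) auto
  next
    case (Suc m)
    then obtain w where "w \<in> words_M (real c)" "height w = int m" "mset (drops 0 w) = {#}" by blast
    then show ?case by (intro bexI[of _ "w @ [U]"]) (auto simp: words_M_snoc_U)
  qed
  from this[of "nat (H - 1)"] obtain w where "w \<in> words_M (real c)"
    "height w = int (nat (H - 1))" "mset (drops 0 w) = {#}" by blast
  then show ?case using 0 by (intro bexI[of _ w]) auto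
next
  case (Suc k)
  define a where "a = int c - 1"
  have a: "a \<ge> 0" using assms(1) by (simp add: a_def)
  note IH = Suc.IH[folded a_def]
  have mem: "\<exists>w\<in>words_M (real c). height w + 1 = H \<and> mset (drops 0 w) = S"
    if S: "S \<in> ballot_sets a H (Suc k)" and H: "H > a * int (Suc k)" "H \<in># S" for H
  proof -
    obtain T where T: "S = add_mset H T" using H(2) by (metis mset_add)
    with S have "ballot a T" using ballot_mono[of a S T] by (auto simp: ballot_sets_def)
    with S T have "T \<in> ballot_sets a (H + 1) k" by (fastforce simp: ballot_sets_def)
    moreover have "a * int (Suc k) \<ge> a * int k" using a by (simp add: mult_left_mono)
    then have "H + 1 > a * int k" using H(1) by simp
    ultimately obtain w where w: "w \<in> words_M (real c)" "height w = H" "mset (drops 0 w) = T"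
      using IH by fastforce
    then have "count_list w D = size T" using length_drops[of 0 w] by (metis size_mset)
    then have "count_list w D = k" using S T by (simp add: ballot_sets_def)
    with w H(1) have "w @ [D] \<in> words_M (real c)" by (simp add: words_M_snoc_D a_def)
    with w T show ?thesis by (intro bexI[of _ "w @ [D]"]) auto
  qed
  have "H \<ge> a * int (Suc k) + 1" using Suc.prems(2) by (simp add: a_def)
  then show ?case using Suc.prems(1)[folded a_def]
  proof (induction H rule: int_ge_induct)
    case base
    then have "S \<noteq> {#}" "ballot a S" "size S = Suc k" by (auto simp: ballot_sets_def)
    then obtain x where "x \<in># S" "x \<ge> a * int (Suc k) + 1"
      by (metis ballot_obtain_large zless_imp_add1_zle)
    with base have "a * int (Suc k) + 1 \<in># S" by (rule bottom_in_ballot_sets)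
    then show ?case using base by (intro mem) auto
  next
    case (step H)
    show ?case
    proof (cases "H + 1 \<in># S")
      case True
      then show ?thesis using step by (intro mem) auto
    next
      case False
      have "S \<in> ballot_sets a H (Suc k)"
        unfolding ballot_sets_def
      proof (intro CollectI conjI ballI impI)
        fix x assume "x \<in># S" "x > H"
        with False have "x > H + 1" by (cases "x = H + 1") auto
        with \<open>x \<in># S\<close> step.prems show "x - 1 \<in># S" by (auto simp: ballot_sets_def)
      qed (use step.prems in \<open>auto simp: ballot_sets_def\<close>)
      with step.IH obtain w where "w \<in> words_M (real c)" "height w + 1 = H" "mset (drops 0 w) = S"
        by blast
      then show ?thesis by (intro bexI[of _ "w @ [U]"]) (auto simp: words_M_snoc_U)
    qed
  qed
qed

lemma drops_image:
  assumes "c > 0" "n \<ge> (c + 1) * k"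
  shows "(\<lambda>w. mset (drops 0 w)) ` {w \<in> words_M (real c). length w = n \<and> count_list w D = k} =
    ballot_sets (int c - 1) (int (n - 2 * k + 1)) k"
    (is "?f ` ?W = ?A")
proof -
  have "2 * k \<le> (c + 1) * k" using assms(1) by (intro mult_right_mono) auto
  then have le: "2 * k \<le> n" using assms(2) by (rule order_trans)
  show ?thesis
  proof (intro equalityI subsetI)
    fix S assume "S \<in> ?f ` ?W"
    then obtain w where w: "w \<in> words_M (real c)" "length w = n" "count_list w D = k" "S = ?f w"
      by auto
    then have "height w + 1 = int (n - 2 * k + 1)"
      using length_eq_count_letters[of w] le by (simp add: height_def of_nat_diff)
    with drops_in_ballot_sets[OF assms(1) w(1)] w show "S \<in> ?A" by simp
  next
    fix S assume S: "S \<in> ?A"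
    have "int n \<ge> (int c + 1) * int k"
      using assms(2) by (metis of_nat_1 of_nat_add of_nat_le_iff of_nat_mult)
    then have "int (n - 2 * k + 1) > (int c - 1) * int k"
      using le by (simp add: of_nat_diff algebra_simps)
    from word_of_ballot_set[OF assms(1) S this] obtain w where w: "w \<in> words_M (real c)"
      "height w + 1 = int (n - 2 * k + 1)" "?f w = S" by blast
    then have "count_list w D = size S" using length_drops[of 0 w] by (metis size_mset)
    then have k: "count_list w D = k" using S by (simp add: ballot_sets_def)
    then have "length w = n" using w(2) le length_eq_count_letters[of w]
      by (simp add: height_def of_nat_diff)
    with w k show "S \<in> ?f ` ?W" by auto
  qed
qed

section \<open>Weyl equivalence\<close>

text \<open>A function \<open>f\<close> on the integers stands for the formal Laurent series with coefficients \<open>f m\<close>.\<close>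

primrec letter_act :: "letter \<Rightarrow> (int \<Rightarrow> 'k::field) \<Rightarrow> int \<Rightarrow> 'k" where
  "letter_act U f = (\<lambda>m. f (m - 1))"
| "letter_act D f = (\<lambda>m. of_int (m + 1) * f (m + 1))"

primrec word_act :: "letter list \<Rightarrow> (int \<Rightarrow> 'k::field) \<Rightarrow> int \<Rightarrow> 'k" where
  "word_act [] f = f"
| "word_act (x # w) f = letter_act x (word_act w f)"

definition act :: "(word \<Rightarrow>\<^sub>0 'k::field) \<Rightarrow> (int \<Rightarrow> 'k) \<Rightarrow> int \<Rightarrow> 'k" where
  "act p f m = (\<Sum>w\<in>Poly_Mapping.keys p. Poly_Mapping.lookup p w * word_act (letters w) f m)"

lemma word_act_append [simp]: "word_act (u @ v) f = word_act u (word_act v f)"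
  by (induction u) simp_all

lemma letter_act_linear:
  "letter_act x (\<lambda>m. f m + g m) = (\<lambda>m. letter_act x f m + letter_act x g m)"
  "letter_act x (\<lambda>m. c * f m) = (\<lambda>m. c * letter_act x f m)"
  by (cases x; simp add: fun_eq_iff algebra_simps)+

lemma word_act_linear:
  "word_act w (\<lambda>m. f m + g m) = (\<lambda>m. word_act w f m + word_act w g m)"
  "word_act w (\<lambda>m. c * f m) = (\<lambda>m. c * word_act w f m)"
  by (induction w) (simp_all add: letter_act_linear)

lemma act_zero [simp]: "act 0 f = (\<lambda>m. 0)"
  by (simp add: act_def fun_eq_iff)

lemma act_add: "act (p + q) f = (\<lambda>m. act p f m + act q f m)"
  unfolding act_def fun_eq_iff
  using setsum_keys_plus_distrib[of "\<lambda>w c. c * word_act (letters w) f _" p q]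
  by (simp add: algebra_simps)

lemma act_single: "act (Poly_Mapping.single w c) f = (\<lambda>m. c * word_act (letters w) f m)"
  by (simp add: act_def fun_eq_iff)

lemma poly_mapping_additive_induct [case_names zero single add]:
  fixes p :: "'a \<Rightarrow>\<^sub>0 'b::monoid_add"
  assumes "P 0" "\<And>w c. P (Poly_Mapping.single w c)" "\<And>p q. P p \<Longrightarrow> P q \<Longrightarrow> P (p + q)"
  shows "P p"
proof (induction p rule: update_induct)
  case (update p w c)
  have w: "Poly_Mapping.lookup p w = 0" using update.hyps(1) by (metis in_keys_iff)
  have "Poly_Mapping.update w c p = Poly_Mapping.single w c + p"
    by (rule poly_mapping_eqI)
      (auto simp: lookup_update lookup_add lookup_single when_def w)
  then show ?case using assms update by simp
qed (rule assms(1))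

lemma act_fun_linear:
  "act p (\<lambda>m. f m + g m) = (\<lambda>m. act p f m + act p g m)"
  "act p (\<lambda>m. c * f m) = (\<lambda>m. c * act p f m)"
  by (simp_all add: act_def fun_eq_iff word_act_linear algebra_simps sum.distrib sum_distrib_left)

lemma act_zero_fun [simp]: "act p (\<lambda>m. 0) = (\<lambda>m. 0)"
  using act_fun_linear(2)[of p 0 "\<lambda>m. 0"] by simp

lemma act_mult: "act (p * q) f = act p (act q f)"
proof (induction p rule: poly_mapping_additive_induct)
  case (single v a)
  show ?case
  proof (induction q rule: poly_mapping_additive_induct)
    case (single w b)
    then show ?case
      by (simp add: mult_single act_single plus_word_def word_act_linear mult.assoc)
  qed (simp_all add: distrib_left act_add act_fun_linear)
qed (simp_all add: distrib_right act_add)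

lemma act_minus [simp]: "act (- p) f = (\<lambda>m. - act p f m)"
  using act_add[of p "- p" f] by (simp add: fun_eq_iff) (metis minus_unique)

lemma act_diff: "act (p - q) f = (\<lambda>m. act p f m - act q f m)"
  using act_add[of p "- q" f] by simp

lemma act_one [simp]: "act 1 f = f"
  by (simp add: act_single zero_word_def flip: single_one)

lemma act_weyl_relation:
  "act (letter_poly D * letter_poly U - letter_poly U * letter_poly D - 1) f = (\<lambda>m. 0)"
  unfolding act_diff act_mult act_one letter_poly_def act_single
  by (simp add: fun_eq_iff algebra_simps)

lemma free_algebra_simps [simp]:
  "carrier (free_algebra :: (word \<Rightarrow>\<^sub>0 'k::field) ring) = UNIV"
  "monoid.mult (free_algebra :: (word \<Rightarrow>\<^sub>0 'k::field) ring) = (*)"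
  "one (free_algebra :: (word \<Rightarrow>\<^sub>0 'k::field) ring) = 1"
  "zero (free_algebra :: (word \<Rightarrow>\<^sub>0 'k::field) ring) = 0"
  "add (free_algebra :: (word \<Rightarrow>\<^sub>0 'k::field) ring) = (+)"
  by (simp_all add: free_algebra_def)

lemma a_inv_free_algebra [simp]:
  "\<ominus>\<^bsub>free_algebra\<^esub> (p :: word \<Rightarrow>\<^sub>0 'k::field) = - p"
  by (rule abelian_group.minus_equality[OF ring.is_abelian_group[OF ring_free_algebra]]) simp_all

lemma a_minus_free_algebra [simp]:
  "p \<ominus>\<^bsub>free_algebra\<^esub> q = p - (q :: word \<Rightarrow>\<^sub>0 'k::field)"
  by (simp add: a_minus_def)

lemma weyl_ideal_act:
  assumes "p \<in> (weyl_ideal :: (word \<Rightarrow>\<^sub>0 'k::field) set)"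
  shows "act p f = (\<lambda>m. 0)"
proof -
  let ?J = "{p :: word \<Rightarrow>\<^sub>0 'k. \<forall>f. act p f = (\<lambda>m. 0)}"
  have "ideal ?J free_algebra"
  proof (rule idealI[OF ring_free_algebra])
    show "subgroup ?J (add_monoid free_algebra)"
    proof (rule group.subgroupI)
      show "group (add_monoid (free_algebra :: (word \<Rightarrow>\<^sub>0 'k) ring))"
        by (rule abelian_group.a_group[OF ring.is_abelian_group[OF ring_free_algebra]])
      have "inv\<^bsub>add_monoid free_algebra\<^esub> p = - p" for p :: "word \<Rightarrow>\<^sub>0 'k"
        using a_inv_free_algebra[of p] by (simp only: a_inv_def)
      then show "inv\<^bsub>add_monoid free_algebra\<^esub> p \<in> ?J" if "p \<in> ?J" for p
        using that by simp
      show "?J \<noteq> {}" by (auto intro!: exI[of _ 0])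
    qed (auto simp: act_add)
  qed (auto simp: act_mult)
  then have "weyl_ideal \<subseteq> ?J"
    unfolding weyl_ideal_def
    by (rule ring.genideal_minimal[OF ring_free_algebra]) (simp add: act_weyl_relation)
  with assms show ?thesis by blast
qed

abbreviation word_poly :: "letter list \<Rightarrow> (word \<Rightarrow>\<^sub>0 'k::field)" where
  "word_poly w \<equiv> Poly_Mapping.single (Word w) 1"

lemma word_poly_append: "word_poly (u @ v) = word_poly u * word_poly v"
  by (simp add: mult_single plus_word_def)

lemma weyl_phi_eq_coset:
  "weyl_phi w = weyl_ideal +>\<^bsub>free_algebra\<^esub> (word_poly w :: word \<Rightarrow>\<^sub>0 'k::field)"
proof (induction w)
  case Nil
  have "word_poly [] = (1 :: word \<Rightarrow>\<^sub>0 'k)"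
    by (metis single_one zero_word_def)
  then show ?case by (simp add: weyl_algebra_def FactRing_def)
next
  case (Cons x w)
  then show ?case
    using word_poly_append[of "[x]" w, where 'a = 'k]
    by (simp add: weyl_algebra_def FactRing_def weyl_gen_def letter_poly_def
        ideal.rcoset_mult_add[OF ideal_weyl_ideal])
qed

definition weyl_cong :: "(word \<Rightarrow>\<^sub>0 'k::field) \<Rightarrow> (word \<Rightarrow>\<^sub>0 'k) \<Rightarrow> bool" (infix "\<cong>\<^sub>W" 50) where
  "p \<cong>\<^sub>W q \<longleftrightarrow> p - q \<in> weyl_ideal"

lemma weyl_phi_eq_iff:
  "(weyl_phi u :: (word \<Rightarrow>\<^sub>0 'k::field) set) = weyl_phi v \<longleftrightarrow>
     (word_poly u :: word \<Rightarrow>\<^sub>0 'k) \<cong>\<^sub>W word_poly v"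
  using ring.quotient_eq_iff_same_a_r_cos[OF ring_free_algebra ideal_weyl_ideal,
      of "word_poly u :: word \<Rightarrow>\<^sub>0 'k" "word_poly v"]
  by (simp add: weyl_cong_def weyl_phi_eq_coset)

lemma word_act_one:
  "word_act w f (m - h) = (\<Prod>x\<leftarrow>drops h w. of_int (m + 1 - x)) * f (m - h - height w)"
proof (induction h w rule: drops.induct)
  case (3 h w)
  have "m - h + 1 = m - (h - 1)" by simp
  then show ?case using 3 by (simp add: algebra_simps)
qed (simp_all add: algebra_simps)

lemma mset_eq_if_linear_prods_eq:
  fixes xs ys :: "int list"
  assumes "\<And>m. (\<Prod>x\<leftarrow>xs. of_int (m - x)) = (\<Prod>x\<leftarrow>ys. of_int (m - x) :: 'k::field_char_0)"
  shows "mset xs = mset ys"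
proof -
  define P where "P zs = (\<Prod>x\<leftarrow>zs. [:- of_int x, 1 :: 'k:])" for zs
  have eval: "poly (P zs) (of_int m) = (\<Prod>x\<leftarrow>zs. of_int (m - x))" for zs m
    unfolding P_def by (induction zs) (simp_all add: algebra_simps)
  have nz: "P zs \<noteq> 0" for zs
    unfolding P_def by (induction zs) (simp_all del: mult_pCons_left)
  have roots: "proots (P zs) = mset (map of_int zs)" for zs
    using nz unfolding P_def
    by (induction zs) (simp_all add: proots_mult del: mult_pCons_left)
  have "range of_int \<subseteq> {x. poly (P xs - P ys) x = 0}"
    using assms by (auto simp: eval)
  moreover have "infinite (range (of_int :: int \<Rightarrow> 'k))"
    by (simp add: finite_image_iff inj_on_def)
  ultimately have "P xs - P ys = 0"
    using poly_roots_finite finite_subset by blast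
  then have "P xs = P ys" by simp
  then have "mset (map of_int xs) = mset (map (of_int :: int \<Rightarrow> 'k) ys)"
    by (metis roots)
  then have "image_mset (of_int :: int \<Rightarrow> 'k) (mset xs) = image_mset of_int (mset ys)"
    by simp
  then show ?thesis
    using injD[OF multiset.inj_map[of "of_int :: int \<Rightarrow> 'k"]] by (simp add: inj_def)
qed

lemma mset_drops_eq_if_weyl_phi_eq:
  assumes "(weyl_phi u :: (word \<Rightarrow>\<^sub>0 'k::field_char_0) set) = weyl_phi v"
  shows "mset (drops 0 u) = mset (drops 0 v)"
proof -
  have "(word_poly u - word_poly v :: word \<Rightarrow>\<^sub>0 'k) \<in> weyl_ideal"
    using assms by (simp add: weyl_phi_eq_iff weyl_cong_def)
  from weyl_ideal_act[OF this]
  have "act (word_poly u + - word_poly v :: word \<Rightarrow>\<^sub>0 'k) (\<lambda>_. 1) m = 0" for m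
    by simp
  then have "word_act u (\<lambda>_. 1 :: 'k) m = word_act v (\<lambda>_. 1) m" for m
    unfolding act_add act_minus act_single by simp
  then have "(\<Prod>x\<leftarrow>drops 0 u. of_int (m + 1 - x) :: 'k) = (\<Prod>x\<leftarrow>drops 0 v. of_int (m + 1 - x))" for m
    using word_act_one[of u "\<lambda>_. 1 :: 'k" m 0] word_act_one[of v "\<lambda>_. 1 :: 'k" m 0] by simp
  from this[of "_ - 1"] show ?thesis
    by (intro mset_eq_if_linear_prods_eq[where 'k = 'k]) simp
qed

lemma weyl_cong_refl [simp]: "p \<cong>\<^sub>W p"
  using additive_subgroup.zero_closed[OF ideal.axioms(1)[OF ideal_weyl_ideal]]
  by (simp add: weyl_cong_def)

lemma weyl_cong_trans [trans]: "p \<cong>\<^sub>W q \<Longrightarrow> q \<cong>\<^sub>W r \<Longrightarrow> p \<cong>\<^sub>W r"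
  using additive_subgroup.a_closed[OF ideal.axioms(1)[OF ideal_weyl_ideal], of "p - q" "q - r"]
  by (simp add: weyl_cong_def)

lemma weyl_cong_sym: "p \<cong>\<^sub>W q \<Longrightarrow> q \<cong>\<^sub>W p"
  using additive_subgroup.a_inv_closed[OF ideal.axioms(1)[OF ideal_weyl_ideal], of "p - q"]
  by (simp add: weyl_cong_def)

lemma weyl_cong_mult_left: "p \<cong>\<^sub>W q \<Longrightarrow> r * p \<cong>\<^sub>W r * q"
  using ideal.I_l_closed[OF ideal_weyl_ideal, of "p - q" r]
  by (simp add: weyl_cong_def right_diff_distrib)

lemma weyl_cong_mult_right: "p \<cong>\<^sub>W q \<Longrightarrow> p * r \<cong>\<^sub>W q * r"
  using ideal.I_r_closed[OF ideal_weyl_ideal, of "p - q" r]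
  by (simp add: weyl_cong_def left_diff_distrib)

lemma weyl_cong_diff_right: "p \<cong>\<^sub>W q \<Longrightarrow> p - r \<cong>\<^sub>W q - r"
  by (simp add: weyl_cong_def)

definition euler :: "word \<Rightarrow>\<^sub>0 'k::field" where
  "euler = letter_poly U * letter_poly D"

lemma weyl_relation: "letter_poly D * letter_poly U \<cong>\<^sub>W letter_poly U * letter_poly D + 1"
  using ring.genideal_self'[OF ring_free_algebra,
      of "letter_poly D * letter_poly U - letter_poly U * letter_poly D - 1"]
  by (simp add: weyl_cong_def weyl_ideal_def algebra_simps)

lemma U_euler:
  "letter_poly U * (euler - of_int j) \<cong>\<^sub>W
     (euler - of_int (j + 1)) * (letter_poly U :: word \<Rightarrow>\<^sub>0 'k::field)"
proof -
  let ?U = "letter_poly U :: word \<Rightarrow>\<^sub>0 'k" and ?D = "letter_poly D :: word \<Rightarrow>\<^sub>0 'k"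
  have "?U * (?U * ?D + 1) - ?U * of_int (j + 1) \<cong>\<^sub>W ?U * (?D * ?U) - ?U * of_int (j + 1)"
    by (rule weyl_cong_diff_right[OF weyl_cong_sym[OF weyl_cong_mult_left[OF weyl_relation]]])
  moreover have "?U * (euler - of_int j) = ?U * (?U * ?D + 1) - ?U * of_int (j + 1)"
    by (simp add: euler_def algebra_simps)
  moreover have "(euler - of_int (j + 1)) * ?U = ?U * (?D * ?U) - ?U * of_int (j + 1)"
    by (simp only: euler_def left_diff_distrib mult.assoc mult_of_int_commute[of "j + 1" ?U])
  ultimately show ?thesis by simp
qed

lemma U_power_D:
  "letter_poly U ^ Suc e * letter_poly D \<cong>\<^sub>W
     (euler - of_int (int e)) * (letter_poly U :: word \<Rightarrow>\<^sub>0 'k::field) ^ e"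
proof (induction e)
  case 0
  show ?case by (simp add: euler_def)
next
  case (Suc e)
  let ?U = "letter_poly U :: word \<Rightarrow>\<^sub>0 'k"
  have "?U * (?U ^ Suc e * letter_poly D)
      \<cong>\<^sub>W ?U * ((euler - of_int (int e)) * ?U ^ e)"
    by (rule weyl_cong_mult_left[OF Suc])
  also have "\<dots> = ?U * (euler - of_int (int e)) * ?U ^ e"
    by (simp only: mult.assoc)
  also have "\<dots> \<cong>\<^sub>W (euler - of_int (int e + 1)) * ?U * ?U ^ e"
    by (rule weyl_cong_mult_right[OF U_euler])
  finally show ?case by (simp add: mult.assoc add.commute)
qed

lemma words_M_1_height_nonneg: "w \<in> words_M 1 \<Longrightarrow> height w \<ge> 0"
  by (auto simp: words_M_def height_def)

lemma word_poly_normal_form: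
  assumes "w \<in> words_M 1"
  shows "word_poly w \<cong>\<^sub>W (\<Prod>x\<leftarrow>drops 0 w. euler - of_int (x - 1)) *
    (letter_poly U :: word \<Rightarrow>\<^sub>0 'k::field) ^ nat (height w)"
  using assms
proof (induction w rule: rev_induct)
  case Nil
  show ?case by (simp flip: zero_word_def)
next
  case (snoc x w)
  let ?P = "\<Prod>x\<leftarrow>drops 0 w. euler - of_int (x - 1) :: word \<Rightarrow>\<^sub>0 'k"
    and ?U = "letter_poly U :: word \<Rightarrow>\<^sub>0 'k"
  have w: "w \<in> words_M 1" using snoc.prems by (simp add: words_M_snoc)
  have "(word_poly (w @ [x]) :: word \<Rightarrow>\<^sub>0 'k) = word_poly w * letter_poly x"
    by (simp add: word_poly_append letter_poly_def)
  also have "\<dots> \<cong>\<^sub>W ?P * ?U ^ nat (height w) * letter_poly x"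
    by (rule weyl_cong_mult_right[OF snoc.IH[OF w]])
  finally have *: "word_poly (w @ [x]) \<cong>\<^sub>W ?P * ?U ^ nat (height w) * letter_poly x" .
  show ?case
  proof (cases x)
    case U
    have "nat (height w + 1) = Suc (nat (height w))" using words_M_1_height_nonneg[OF w] by simp
    with * U show ?thesis by (simp add: mult.assoc power_commutes)
  next
    case D
    have "height w - 1 \<ge> 0" using words_M_1_height_nonneg[OF snoc.prems] D by simp
    then obtain e where e: "height w = int e + 1" by (metis nonneg_int_cases diff_eq_eq)
    then have ne: "nat (height w) = Suc e" by simp
    have "?P * (?U ^ Suc e * letter_poly D) \<cong>\<^sub>W ?P * ((euler - of_int (int e)) * ?U ^ e)"
      by (rule weyl_cong_mult_left[OF U_power_D])
    with * D e ne show ?thesis by (auto simp: mult.assoc intro: weyl_cong_trans)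
  qed
qed

lemma prod_list_map_commute_cong:
  fixes f :: "'a \<Rightarrow> 'b::monoid_mult"
  assumes "\<And>x y. f x * f y = f y * f x" "mset xs = mset ys"
  shows "prod_list (map f xs) = prod_list (map f ys)"
proof -
  have eq: "prod_list (map f zs) = foldr (\<lambda>x. (*) (f x)) zs 1" for zs
    by (induction zs) simp_all
  have "fold (\<lambda>x. (*) (f x)) (rev xs) = fold (\<lambda>x. (*) (f x)) (rev ys)"
    by (rule fold_multiset_equiv) (use assms in \<open>auto simp: fun_eq_iff simp flip: mult.assoc\<close>)
  then show ?thesis by (simp add: eq foldr_conv_fold)
qed

lemma weyl_phi_eq_iff_drops:
  assumes "u \<in> words_M 1" "v \<in> words_M 1" "height u = height v"
  shows "(weyl_phi u :: (word \<Rightarrow>\<^sub>0 'k::field_char_0) set) = weyl_phi v \<longleftrightarrow>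
    mset (drops 0 u) = mset (drops 0 v)"
proof
  let ?P = "\<lambda>w. \<Prod>x\<leftarrow>drops 0 w. euler - of_int (x - 1) :: word \<Rightarrow>\<^sub>0 'k"
  assume "mset (drops 0 u) = mset (drops 0 v)"
  moreover have "(euler - of_int i) * (euler - of_int j) =
      (euler - of_int j) * (euler - of_int i :: word \<Rightarrow>\<^sub>0 'k)" for i j
    by (simp add: left_diff_distrib right_diff_distrib mult_of_int_commute[of _ euler]
        mult_of_int_commute[of i "of_int j"])
  ultimately have "?P u = ?P v"
    by (intro prod_list_map_commute_cong)
  then have eq: "?P u * letter_poly U ^ nat (height u) = ?P v * letter_poly U ^ nat (height v)"
    using assms(3) by simp
  have "(word_poly u :: word \<Rightarrow>\<^sub>0 'k) \<cong>\<^sub>W word_poly v"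
    by (rule weyl_cong_trans[OF word_poly_normal_form[where 'k = 'k, OF assms(1), unfolded eq]
          weyl_cong_sym[OF word_poly_normal_form[where 'k = 'k, OF assms(2)]]])
  then show "(weyl_phi u :: (word \<Rightarrow>\<^sub>0 'k) set) = weyl_phi v"
    by (simp add: weyl_phi_eq_iff)
qed (rule mset_drops_eq_if_weyl_phi_eq)

lemma words_M_antimono: "0 \<le> b \<Longrightarrow> b \<le> c \<Longrightarrow> words_M c \<subseteq> words_M b"
  unfolding words_M_def by (auto intro: order_trans[OF mult_right_mono])

lemma card_image_eq_if_same_kernel:
  assumes "\<And>x y. x \<in> X \<Longrightarrow> y \<in> X \<Longrightarrow> f x = f y \<longleftrightarrow> g x = g y"
  shows "card (f ` X) = card (g ` X)"
proof (rule bij_betw_same_card)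
  show "bij_betw (\<lambda>z. g (inv_into X f z)) (f ` X) (g ` X)"
    unfolding bij_betw_def inj_on_def
    using assms by (auto simp: inv_into_into f_inv_into_f image_iff) (metis f_inv_into_f imageI inv_into_into)+
qed

lemma equiv_weyl_equiv: "equiv UNIV (weyl_equiv K)"
  by (auto simp: equiv_def refl_on_def sym_def trans_def weyl_equiv_def)

lemma num_classes_eq_card_image:
  "num_classes K c n k =
    card ((\<lambda>w. weyl_equiv K `` {w}) ` {w \<in> words_M c. length w = n \<and> count_list w D = k})"
proof -
  have "{C \<in> UNIV // weyl_equiv K. \<exists>w\<in>C. w \<in> words_M c \<and> length w = n \<and> count_list w D = k} =
    (\<lambda>w. weyl_equiv K `` {w}) ` {w \<in> words_M c. length w = n \<and> count_list w D = k}"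
    (is "?L = ?R")
  proof (intro equalityI subsetI)
    fix C assume "C \<in> ?L"
    then obtain w where C: "C \<in> UNIV // weyl_equiv K" "w \<in> C"
      and w: "w \<in> words_M c" "length w = n" "count_list w D = k" by blast
    obtain u where "C = weyl_equiv K `` {u}" using C(1) by (elim quotientE)
    with C(2) have "C = weyl_equiv K `` {w}"
      by (simp add: equiv_class_eq[OF equiv_weyl_equiv])
    with w show "C \<in> ?R" by blast
  next
    fix C assume "C \<in> ?R"
    then show "C \<in> ?L"
      using equiv_class_self[OF equiv_weyl_equiv] by (auto simp: quotientI)
  qed
  then show ?thesis by (simp add: num_classes_def)
qed

theorem theorem6p11:
  fixes c n k :: nat
  assumes "c > 0" and "n > 0" and "k > 0"
    and "n \<ge> (c + 1) * k"
  shows "int (num_classes TYPE('k::field_char_0) (real c) n k) =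
    int ((n - k - 1) choose k) - (int c - 2) * (\<Sum>j = 0..k - 1. int ((n - k - 1) choose j))"
proof -
  let ?W = "{w \<in> words_M (real c). length w = n \<and> count_list w D = k}"
  let ?S = "\<Sum>j<k. int ((n - k - 1) choose j)"
  have "weyl_equiv TYPE('k) `` {u} = weyl_equiv TYPE('k) `` {v} \<longleftrightarrow>
      mset (drops 0 u) = mset (drops 0 v)" if "u \<in> ?W" "v \<in> ?W" for u v
  proof -
    have "words_M (real c) \<subseteq> words_M 1" using assms(1) by (intro words_M_antimono) auto
    moreover have "height u = height v"
      using that length_eq_count_letters[of u] length_eq_count_letters[of v]
      by (simp add: height_def)
    ultimately have "(u, v) \<in> weyl_equiv TYPE('k) \<longleftrightarrow> mset (drops 0 u) = mset (drops 0 v)"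
      using that weyl_phi_eq_iff_drops[where 'k = 'k, of u v] by (auto simp: weyl_equiv_def)
    then show ?thesis by (simp add: eq_equiv_class_iff[OF equiv_weyl_equiv])
  qed
  then have "num_classes TYPE('k) (real c) n k = card ((\<lambda>w. mset (drops 0 w)) ` ?W)"
    unfolding num_classes_eq_card_image by (rule card_image_eq_if_same_kernel)
  also have "\<dots> = card (ballot_sets (int (c - 1)) (int (n - 2 * k + 1)) k)"
    using assms(1) by (simp add: drops_image[OF assms(1,4)] of_nat_diff)
  finally have eq: "num_classes TYPE('k) (real c) n k =
      card (ballot_sets (int (c - 1)) (int (n - 2 * k + 1)) k)" .
  obtain a where a: "c = Suc a" using assms(1) by (cases c) auto
  have le: "2 * k + a * k \<le> n" using assms(4) by (simp add: a algebra_simps)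
  then have idx: "n - 2 * k + 1 + k - 2 = n - k - 1" using assms(3) by simp
  have "(c - 1) * k + 1 \<le> n - 2 * k + 1" using le by (simp add: a)
  from conjunct2[OF card_ballot_sets[OF this, unfolded idx]]
  have "int (num_classes TYPE('k) (real c) n k) = ?S + int ((n - k - 1) choose k) - int a * ?S"
    unfolding eq by (simp add: a)
  moreover have "{0..k - 1} = {..<k}" using assms(3) by auto
  ultimately show ?thesis by (simp add: a algebra_simps)
qed

end
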